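(* There exists an absolute constant $c>0$ such that the following holds for all sufficiently large real $B$: for all $N,k\in\mathbb{N}$, with $m:=\prod_{2<r\le B} r$ (product over primes $r$) and $\gcd(Nk,m)=1$, we have \[ |\mathcal{L}_{N,m,k}|\le c\,\frac{m\log B}{2^{\omega(m)}}, \] i.e. $|\mathcal{L}_{N,m,k}|\in O\big(m\log B/2^{\omega(m)}\big)$, where $\omega(m)$ is the number of distinct prime divisors of $m$.
   Context: For $N,m,k\in\mathbb{N}$ with $\gcd(Nk,m)=1$, $\mathcal{H}_{N,m}:=\{(x,y)\in(\mathbb{Z}/m\mathbb{Z})^2: xy\equiv N \bmod m\}$ and $\mathcal{L}_{N,m,k}:=\{kx+y\bmod m:(x,y)\in\mathcal{H}_{N,m}\}$. *)

theory Defs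
  imports Complex_Main "HOL-Number_Theory.Number_Theory"
begin

(* For m > 0, a residue class in Z/mZ is represented by its least nonnegative
   representative, so Z/mZ is {..<m} and the cardinality of a set of residue classes
   is the cardinality of the set of representatives. *)

definition mod_hyperbola :: "nat \<Rightarrow> nat \<Rightarrow> (nat \<times> nat) set" where
  "mod_hyperbola N m = {(x, y). x < m \<and> y < m \<and> [x * y = N] (mod m)}"

definition hyperbola_values :: "nat \<Rightarrow> nat \<Rightarrow> nat \<Rightarrow> nat set" where
  "hyperbola_values N m k = {(k * x + y) mod m |x y. (x, y) \<in> mod_hyperbola N m}"

end

theory Submission
  imports Defs
begin

text \<open>
  By the Chinese remainder theorem the number of values is at most the product of the numbers of
  values modulo the primes \<open>p\<close> dividing \<open>m\<close>. Modulo \<open>p\<close>, the form \<open>k x + y\<close> is invariant under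
  the involution \<open>(x, y) \<mapsto> (y / k, k x)\<close> of the hyperbola. The hyperbola has at most \<open>p - 1\<close> points
  and the involution at most two fixed points, so there are at most \<open>(p + 1) / 2\<close> values. It remains
  to bound \<open>\<Prod>p\<le>B. 1 + 1 / p\<close> by a multiple of \<open>ln B\<close>, which is the upper half of Mertens' theorem:
  the primorial bound \<open>4 ^ n\<close> and the factorisation of \<open>n!\<close> give \<open>\<Sum>p\<le>n. ln p / p \<le> ln n + ln 4\<close>,
  and partial summation gives \<open>\<Sum>p\<le>n. 1 / p \<le> ln (ln n) + O(1)\<close>.
\<close>

section \<open>Reduction to prime moduli by the Chinese remainder theorem\<close>

lemma hyperbola_values_image:
  "hyperbola_values N m k = (\<lambda>(x, y). (k * x + y) mod m) ` mod_hyperbola N m"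
  unfolding hyperbola_values_def by force

lemma finite_mod_hyperbola: "finite (mod_hyperbola N m)"
  by (rule finite_subset[of _ "{..<m} \<times> {..<m}"]) (auto simp: mod_hyperbola_def)

lemma finite_hyperbola_values: "finite (hyperbola_values N m k)"
  by (simp add: hyperbola_values_image finite_mod_hyperbola)

lemma hyperbola_values_mod:
  assumes "d dvd m" "0 < d" "v \<in> hyperbola_values N m k"
  shows "v mod d \<in> hyperbola_values N d k"
proof -
  obtain x y where v: "v = (k * x + y) mod m" and xy: "[x * y = N] (mod m)"
    using assms(3) by (auto simp: hyperbola_values_def mod_hyperbola_def)
  have "[x * y = N] (mod d)"
    using xy assms(1) cong_dvd_modulus_nat by blast
  hence "[(x mod d) * (y mod d) = N] (mod d)"
    by (simp add: cong_def mod_mult_eq)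
  hence "(x mod d, y mod d) \<in> mod_hyperbola N d"
    using assms(2) by (simp add: mod_hyperbola_def)
  moreover have "v mod d = (k * (x mod d) + y mod d) mod d"
    unfolding v mod_mod_cancel[OF assms(1)]
    by (metis mod_add_eq mod_mod_trivial mod_mult_right_eq)
  ultimately show ?thesis
    unfolding hyperbola_values_def by blast
qed

text \<open>A residue modulo \<open>a * b\<close> is determined by its residues modulo
  \<open>a\<close> and \<open>b\<close>, and reducing a value modulo either factor gives a value for
  that factor.\<close>

lemma card_hyperbola_values_mult_le:
  assumes "coprime a b" "0 < a" "0 < b"
  shows "card (hyperbola_values N (a * b) k)
           \<le> card (hyperbola_values N a k) * card (hyperbola_values N b k)"
proof -
  let ?f = "\<lambda>v. (v mod a, v mod b)"
  have "inj_on ?f (hyperbola_values N (a * b) k)"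
  proof (rule inj_onI)
    fix u v assume u: "u \<in> hyperbola_values N (a * b) k"
      and v: "v \<in> hyperbola_values N (a * b) k" and eq: "?f u = ?f v"
    have "u < a * b" "v < a * b"
      using u v assms by (auto simp: hyperbola_values_def)
    moreover have "[u = v] (mod a * b)"
      using eq assms(1) by (intro coprime_cong_mult_nat) (auto simp: cong_def)
    ultimately show "u = v"
      by (simp add: cong_def)
  qed
  moreover have "?f ` hyperbola_values N (a * b) k
                   \<subseteq> hyperbola_values N a k \<times> hyperbola_values N b k"
    using assms by (auto intro: hyperbola_values_mod[of _ "a * b"])
  ultimately have "card (hyperbola_values N (a * b) k)
                     \<le> card (hyperbola_values N a k \<times> hyperbola_values N b k)"
    by (rule card_inj_on_le) (simp add: finite_hyperbola_values)
  thus ?thesis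
    by (simp add: card_cartesian_product)
qed

section \<open>Counting values modulo a prime\<close>

lemma card_mod_hyperbola_prime_le:
  assumes "prime p" "\<not> p dvd N"
  shows "card (mod_hyperbola N p) \<le> p - 1"
proof -
  have nz: "x \<in> {1..<p}" if "(x, y) \<in> mod_hyperbola N p" for x y
  proof -
    have "\<not> p dvd x * y"
      using that assms(2) by (auto simp: mod_hyperbola_def cong_dvd_iff)
    thus ?thesis using that by (cases x) (auto simp: mod_hyperbola_def)
  qed
  \<comment> \<open>Both coordinates are units modulo \<open>p\<close>, so the first one determines
    the second.\<close>
  have "inj_on fst (mod_hyperbola N p)"
  proof (rule inj_onI, clarsimp)
    fix x y z assume xy: "(x, y) \<in> mod_hyperbola N p" and xz: "(x, z) \<in> mod_hyperbola N p"
    have "coprime x p"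
      using nz[OF xy] assms(1) by (metis atLeastLessThan_iff coprime_commute dvd_imp_le
        not_less prime_imp_coprime less_eq_Suc_le One_nat_def)
    moreover have "[x * y = x * z] (mod p)"
      using xy xz by (auto simp: mod_hyperbola_def cong_def)
    ultimately have "[y = z] (mod p)"
      by (simp add: cong_mult_lcancel_nat)
    thus "y = z" using xy xz by (simp add: mod_hyperbola_def cong_def)
  qed
  moreover have "fst ` mod_hyperbola N p \<subseteq> {1..<p}"
    using nz by auto
  ultimately have "card (mod_hyperbola N p) \<le> card {1..<p}"
    by (rule card_inj_on_le) simp
  thus ?thesis by simp
qed

text \<open>These are the fixed points of the involution. Their first coordinates satisfy k x^2 = N,
  so any two of them agree up to sign modulo \<open>p\<close>.\<close>

lemma card_square_root_pairs_le:
  assumes "prime p" "\<not> p dvd N * k"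
  shows "card {(x, y) \<in> mod_hyperbola N p. y = k * x mod p} \<le> 2" (is "card ?F \<le> 2")
proof (cases "?F = {}")
  case False
  then obtain a where a: "(a, k * a mod p) \<in> ?F" by auto
  have "x = a \<or> x = p - a" if "(x, k * x mod p) \<in> mod_hyperbola N p" for x
  proof -
    have lt: "x < p" "a < p" using that a by (auto simp: mod_hyperbola_def)
    have "[x * (k * x) = N] (mod p)" "[a * (k * a) = N] (mod p)"
      using that a by (auto simp: mod_hyperbola_def cong_def mod_simps)
    \<comment> \<open>The difference of squares is factored over the integers, where subtraction
      does not truncate.\<close>
    hence "[int (x * (k * x)) = int (a * (k * a))] (mod int p)"
      by (metis cong_int_iff cong_sym cong_trans)
    hence "int p dvd int (x * (k * x)) - int (a * (k * a))"
      by (simp add: cong_iff_dvd_diff)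
    also have "int (x * (k * x)) - int (a * (k * a)) = int k * ((int x - int a) * (int x + int a))"
      by (simp add: algebra_simps)
    finally have "int p dvd int k \<or> int p dvd int x - int a \<or> int p dvd int x + int a"
      using assms(1) by (simp add: prime_dvd_mult_iff)
    moreover have "\<not> int p dvd int k"
      using assms(2) by auto
    ultimately consider "int p dvd int x - int a" | "p dvd x + a"
      by (metis int_dvd_int_iff of_nat_add)
    thus ?thesis
    proof cases
      case 1
      hence "[x = a] (mod p)" by (metis cong_iff_dvd_diff cong_int_iff)
      thus ?thesis using lt by (simp add: cong_def)
    next
      case 2
      then obtain c where c: "x + a = p * c" by auto
      with lt have "p * c < p * 2" by linarith
      hence "c < 2" by simp
      hence "c = 0 \<or> c = 1" by auto
      thus ?thesis using c lt by auto
    qed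
  qed
  hence "?F \<subseteq> {(a, k * a mod p), (p - a, k * (p - a) mod p)}"
    by auto
  hence "card ?F \<le> card {(a, k * a mod p), (p - a, k * (p - a) mod p)}"
    by (intro card_mono) auto
  also have "\<dots> \<le> 2"
    \<comment> \<open>Bounding by the length of a list avoids deciding whether the two pairs are
      distinct.\<close>
    using card_length[of "[(a, k * a mod p), (p - a, k * (p - a) mod p)]"]
    by (simp only: list.set list.size)
  finally show ?thesis .
next
  case True
  show ?thesis unfolding True by simp
qed

lemma card_hyperbola_values_prime_le:
  assumes "prime p" "\<not> p dvd N * k"
  shows "2 * card (hyperbola_values N p k) \<le> p + 1"
proof -
  let ?H = "mod_hyperbola N p"
  let ?f = "\<lambda>(x, y). (k * x + y) mod p"
  define F where "F = {(x, y) \<in> ?H. y = k * x mod p}"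
  \<comment> \<open>Fixed points get weight 2 and all other points weight 1. Every nonempty fibre of
    the form contains a fixed point or an orbit of size two, so its weight is at least 2, and twice
    the number of values is at most the total weight.\<close>
  let ?g = "\<lambda>z. 1 + (if z \<in> F then 1 else 0) :: nat"
  have p: "0 < p" using assms(1) prime_gt_0_nat by blast
  have "coprime k p"
    using assms by (metis coprime_commute dvd_mult prime_imp_coprime)
  \<comment> \<open>\<open>K\<close> inverts \<open>k\<close> modulo \<open>p\<close>, so
    \<open>K * y\<close> stands for y / k in the involution.\<close>
  then obtain K where K: "[k * K = 1] (mod p)"
    using cong_solve_coprime_nat by auto
  have fibre: "2 \<le> sum ?g {z \<in> ?H. ?f z = v}" if v: "v \<in> ?f ` ?H" for v
  proof -
    obtain x y where xy: "(x, y) \<in> ?H" "?f (x, y) = v" using v by auto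
    let ?A = "{z \<in> ?H. ?f z = v}"
    have fin: "finite ?A" by (simp add: finite_mod_hyperbola)
    \<comment> \<open>the involution \<open>(x, y) \<mapsto> (y / k, k x)\<close> of the hyperbola, whose fixed points are \<open>F\<close>\<close>
    define z where "z = (K * y mod p, k * x mod p)"
    have Ky: "[k * (K * y) = y] (mod p)"
      using cong_scalar_right[OF K, of y] by (simp add: mult.assoc)
    have "[(K * y) * (k * x) = (k * (K * y)) * x] (mod p)"
      by (simp add: ac_simps)
    also have "[(k * (K * y)) * x = y * x] (mod p)"
      by (rule cong_scalar_right[OF Ky])
    also have "[y * x = N] (mod p)"
      using xy by (simp add: mod_hyperbola_def ac_simps)
    finally have "z \<in> ?H"
      using p by (simp add: z_def mod_hyperbola_def cong_def mod_simps)
    moreover have "?f z = (k * (K * y) + k * x) mod p"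
      by (simp add: z_def) (metis mod_add_left_eq mod_add_right_eq mod_mult_right_eq)
    moreover have "\<dots> = (k * x + y) mod p"
      using cong_add[OF Ky cong_refl[of "k * x"]] by (simp add: cong_def add.commute)
    ultimately have zA: "z \<in> ?A" using xy by simp
    have xyA: "(x, y) \<in> ?A" using xy by simp
    show ?thesis
    proof (cases "z = (x, y)")
      case True
      hence "(x, y) \<in> F" using xy by (auto simp: F_def z_def)
      hence "2 \<le> ?g (x, y)" by simp
      also have "\<dots> \<le> sum ?g ?A" using fin xyA by (intro member_le_sum) auto
      finally show ?thesis .
    next
      case False
      have "2 = card {z, (x, y)}" using False by simp
      also have "\<dots> \<le> card ?A" using fin zA xyA by (intro card_mono) auto
      also have "\<dots> \<le> sum ?g ?A" unfolding card_eq_sum by (intro sum_mono) simp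
      finally show ?thesis .
    qed
  qed
  have "2 * card (hyperbola_values N p k) = (\<Sum>v\<in>?f ` ?H. 2)"
    by (simp add: hyperbola_values_image)
  also have "\<dots> \<le> (\<Sum>v\<in>?f ` ?H. sum ?g {z \<in> ?H. ?f z = v})"
    by (intro sum_mono fibre)
  also have "\<dots> = sum ?g ?H"
    by (rule sum.image_gen[symmetric]) (rule finite_mod_hyperbola)
  also have "\<dots> = card ?H + card (?H \<inter> F)"
    unfolding sum.distrib by (simp add: sum.If_cases finite_mod_hyperbola)
  also have "?H \<inter> F = F" by (auto simp: F_def)
  also have "card ?H + card F \<le> (p - 1) + 2"
    unfolding F_def
    using card_mod_hyperbola_prime_le[of p N] card_square_root_pairs_le[OF assms] assms(2)
    by (intro add_mono) (auto simp: assms(1) intro: dvd_mult2)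
  finally show ?thesis using p by linarith
qed

lemma card_hyperbola_values_prod_primes_le:
  assumes "finite P" "\<And>p. p \<in> P \<Longrightarrow> prime p" "\<And>p. p \<in> P \<Longrightarrow> \<not> p dvd N * k"
  shows "real (card (hyperbola_values N (\<Prod>P) k)) \<le> (\<Prod>p\<in>P. (real p + 1) / 2)"
  using assms
proof (induction P)
  case empty
  have "hyperbola_values N 1 k \<subseteq> {0}" by (auto simp: hyperbola_values_def)
  hence "card (hyperbola_values N 1 k) \<le> card {0::nat}" by (intro card_mono) auto
  thus ?case by simp
next
  case (insert p P)
  have "coprime p (\<Prod>P)"
    using insert by (intro prod_coprime_right primes_coprime) auto
  moreover have "0 < \<Prod>P"
    using insert.prems(1) by (intro prod_pos) (auto intro: prime_gt_0_nat)
  ultimately have "card (hyperbola_values N (p * \<Prod>P) k)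
      \<le> card (hyperbola_values N p k) * card (hyperbola_values N (\<Prod>P) k)"
    using insert.prems(1) prime_gt_0_nat by (intro card_hyperbola_values_mult_le) auto
  hence "real (card (hyperbola_values N (p * \<Prod>P) k))
      \<le> real (card (hyperbola_values N p k)) * real (card (hyperbola_values N (\<Prod>P) k))"
    by (simp flip: of_nat_mult)
  also have "\<dots> \<le> ((real p + 1) / 2) * (\<Prod>p\<in>P. (real p + 1) / 2)"
    using card_hyperbola_values_prime_le[of p N k] insert by (intro mult_mono) auto
  finally show ?case using insert.hyps by simp
qed

section \<open>The primorial bound\<close>

definition primes_le :: "nat \<Rightarrow> nat set" where
  "primes_le n = {p. prime p \<and> p \<le> n}"

lemma finite_primes_le [simp]: "finite (primes_le n)"
  by (rule finite_subset[of _ "{..n}"]) (auto simp: primes_le_def)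

lemma primes_le_Suc:
  "primes_le (Suc n) = (if prime (Suc n) then insert (Suc n) (primes_le n) else primes_le n)"
  by (auto simp: primes_le_def le_Suc_eq)

text \<open>Powers of distinct primes are coprime. The exponents \<open>e\<close> are left free
  because the lemma serves both a binomial coefficient, with exponent 1, and a factorial, with
  exponent \<open>n div p\<close>.\<close>

lemma prod_primes_dvd:
  fixes n :: nat
  assumes "finite P" "\<And>p. p \<in> P \<Longrightarrow> prime p" "\<And>p. p \<in> P \<Longrightarrow> p ^ e p dvd n"
  shows "(\<Prod>p\<in>P. p ^ e p) dvd n"
  using assms
proof (induction P)
  case (insert p P)
  have "coprime (p ^ e p) (\<Prod>q\<in>P. q ^ e q)"
    using insert by (intro prod_coprime_right) (auto simp: coprime_power_left_iff coprime_power_right_iff intro!: primes_coprime)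
  thus ?case using insert by (simp add: divides_mult)
qed simp

text \<open>Row \<open>2 * m + 1\<close> sums to 2 * 4^m and contains this coefficient twice, by
  symmetry.\<close>

lemma binomial_odd_le: "(2 * m + 1) choose m \<le> 4 ^ m"
proof -
  have "(2 * m + 1) choose m = (2 * m + 1) choose (m + 1)"
    by (subst binomial_symmetric) auto
  hence "2 * ((2 * m + 1) choose m) = (\<Sum>i\<in>{m, m + 1}. (2 * m + 1) choose i)"
    by simp
  also have "\<dots> \<le> (\<Sum>i\<le>2 * m + 1. (2 * m + 1) choose i)"
    by (intro sum_mono2) auto
  also have "\<dots> = 2 * 4 ^ m"
    unfolding choose_row_sum by (simp add: power_mult)
  finally show ?thesis by simp
qed

text \<open>Such a prime divides the factorial in the numerator but neither factorial in the
  denominator.\<close>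

lemma prime_dvd_binomial_odd:
  fixes p :: nat
  assumes "prime p" "m + 1 < p" "p \<le> 2 * m + 1"
  shows "p dvd (2 * m + 1) choose m"
proof -
  have "fact m * fact (m + 1) * ((2 * m + 1) choose m) = (fact (2 * m + 1) :: nat)"
    using binomial_fact_lemma[of m "2 * m + 1"] by simp
  hence "p dvd fact m * fact (m + 1) * ((2 * m + 1) choose m)"
    using assms by (simp only: prime_dvd_fact_iff)
  moreover have "\<not> p dvd fact m" "\<not> p dvd fact (m + 1)"
    using assms by (simp_all only: prime_dvd_fact_iff)
  ultimately show ?thesis
    using assms(1) by (simp only: prime_dvd_mult_iff) blast
qed

text \<open>Even n > 2 are not prime and add nothing. For n = 2m + 1 the primes up to m + 1 fall
  under the induction hypothesis, and the product of the others divides a binomial coefficient that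
  is at most 4^m.\<close>

lemma primorial_le: "\<Prod>(primes_le n) \<le> 4 ^ n"
proof (induction n rule: less_induct)
  case (less n)
  \<comment> \<open>The condition \<open>m > 0\<close> makes \<open>m + 1\<close> smaller than
    \<open>n\<close>, as the induction requires.\<close>
  consider "n = 0" | "n = 1" | "n = 2" | "n > 2" "even n" | m where "m > 0" "n = 2 * m + 1"
    by (cases "even n") (auto elim!: oddE, (metis One_nat_def Suc_1 even_numeral linorder_neqE_nat less_2_cases gr0I)+)
  thus ?case
  proof cases
    case 1
    thus ?thesis by (auto simp: primes_le_def prod.neutral)
  next
    case 2
    have "primes_le 1 = {}" by (auto simp: primes_le_def dest: prime_gt_1_nat)
    thus ?thesis using 2 by simp
  next
    case 3
    have "primes_le 2 = {2}" by (auto simp: primes_le_def dest: prime_ge_2_nat)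
    thus ?thesis using 3 by simp
  next
    case 4
    then obtain l where l: "n = Suc l" by (cases n) auto
    have "\<not> prime n" using 4 prime_odd_nat by blast
    hence "\<Prod>(primes_le n) = \<Prod>(primes_le l)"
      by (simp add: l primes_le_Suc)
    also have "\<dots> \<le> 4 ^ l" using less l by simp
    also have "\<dots> \<le> 4 ^ n" by (simp add: l)
    finally show ?thesis .
  next
    case (5 m)
    define Q where "Q = {p. prime p \<and> m + 1 < p \<and> p \<le> 2 * m + 1}"
    have Q: "finite Q" by (rule finite_subset[of _ "{..2 * m + 1}"]) (auto simp: Q_def)
    have "primes_le n = primes_le (m + 1) \<union> Q" "primes_le (m + 1) \<inter> Q = {}"
      using 5 by (auto simp: primes_le_def Q_def)
    hence "\<Prod>(primes_le n) = \<Prod>(primes_le (m + 1)) * \<Prod>Q"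
      using Q by (simp add: prod.union_disjoint)
    also have "\<dots> \<le> 4 ^ (m + 1) * 4 ^ m"
    proof (rule mult_mono)
      show "\<Prod>(primes_le (m + 1)) \<le> 4 ^ (m + 1)" using less.IH[of "m + 1"] 5 by simp
      have "\<Prod>Q dvd (2 * m + 1) choose m"
        using prod_primes_dvd[OF Q, of "\<lambda>_. 1"] prime_dvd_binomial_odd by (auto simp: Q_def)
      hence "\<Prod>Q \<le> (2 * m + 1) choose m" by (intro dvd_imp_le) auto
      thus "\<Prod>Q \<le> 4 ^ m" using binomial_odd_le order_trans by blast
    qed auto
    also have "\<dots> = 4 ^ n" using 5 by (simp flip: power_add)
    finally show ?thesis .
  qed
qed

section \<open>Mertens' upper bounds for sums over primes\<close>

lemma power_dvd_fact_mult: "p ^ q dvd (fact (p * q) :: nat)" if "p > 0"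
proof (induction q)
  case (Suc q)
  have "p * Suc q > 0" using that by simp
  hence "(fact (p * Suc q) :: nat) = p * Suc q * fact (p * Suc q - 1)"
    by (subst fact_reduce) auto
  moreover have "p ^ q dvd (fact (p * Suc q - 1) :: nat)"
    using Suc that by (elim dvd_trans) (auto intro!: fact_dvd)
  hence "p * p ^ q dvd p * Suc q * fact (p * Suc q - 1)"
    by (intro mult_dvd_mono) auto
  ultimately show ?case by simp
qed simp

text \<open>The multiples of p up to n contribute p^(n div p) to n!, which is at most n^n. One extra
  factor p for each prime, paid for by the primorial bound, turns the exponent into
  \<open>n div p + 1\<close>, which exceeds n / p. Taking logarithms and dividing by n leaves
  \<open>ln 4\<close> as the price of rounding.\<close>

lemma sum_ln_primes_over_le:
  assumes "n > 0"
  shows "(\<Sum>p\<in>primes_le n. ln p / p) \<le> ln n + ln 4"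
proof -
  let ?P = "primes_le n"
  have pos: "p > 0" if "p \<in> ?P" for p
    using that by (auto simp: primes_le_def intro: prime_gt_0_nat)
  have "p ^ (n div p) dvd (fact n :: nat)" if "p \<in> ?P" for p
    using power_dvd_fact_mult[OF pos[OF that]] fact_dvd[of "p * (n div p)" n]
    by (metis dvd_trans mult.commute times_div_less_eq_dividend div_times_less_eq_dividend)
  hence "(\<Prod>p\<in>?P. p ^ (n div p)) dvd (fact n :: nat)"
    by (intro prod_primes_dvd) (auto simp: primes_le_def)
  hence "(\<Prod>p\<in>?P. p ^ (n div p)) \<le> (fact n :: nat)"
    by (intro dvd_imp_le) auto
  also have "\<dots> \<le> n ^ n" using fact_le_power[where 'a = nat, of n] by simp
  finally have "(\<Prod>p\<in>?P. p ^ (n div p)) \<le> n ^ n" .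
  hence "(\<Prod>p\<in>?P. p ^ (n div p)) * \<Prod>?P \<le> n ^ n * 4 ^ n"
    using primorial_le by (rule mult_mono) auto
  hence "(\<Prod>p\<in>?P. p ^ (n div p + 1)) \<le> n ^ n * 4 ^ n"
    by (simp add: prod.distrib mult.commute)
  hence "real (\<Prod>p\<in>?P. p ^ (n div p + 1)) \<le> real (n ^ n * 4 ^ n)"
    by (simp only: of_nat_le_iff)
  hence "ln (\<Prod>p\<in>?P. real p ^ (n div p + 1)) \<le> ln (real n ^ n * 4 ^ n)"
    using pos assms by (subst ln_le_cancel_iff) (auto intro!: prod_pos)
  also have "ln (\<Prod>p\<in>?P. real p ^ (n div p + 1)) = (\<Sum>p\<in>?P. ln (real p ^ (n div p + 1)))"
    using pos by (intro ln_prod) (auto dest: pos)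
  also have "ln (real n ^ n * 4 ^ n) = n * (ln n + ln 4)"
    using assms by (simp add: ln_mult ln_realpow algebra_simps)
  also have "(\<Sum>p\<in>?P. ln (real p ^ (n div p + 1))) = (\<Sum>p\<in>?P. (n div p + 1) * ln p)"
    using pos by (intro sum.cong) (auto simp: ln_realpow simp del: power_Suc)
  finally have *: "(\<Sum>p\<in>?P. (n div p + 1) * ln p) \<le> n * (ln n + ln 4)" .
  have "n * (\<Sum>p\<in>?P. ln p / p) = (\<Sum>p\<in>?P. n / p * ln p)"
    by (simp add: sum_distrib_left)
  also have "\<dots> \<le> (\<Sum>p\<in>?P. (n div p + 1) * ln p)"
  proof (intro sum_mono mult_right_mono)
    fix p assume p: "p \<in> ?P"
    have "n < (n div p + 1) * p"
      using pos[OF p] dividend_less_div_times[of p n] by simp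
    hence "real n \<le> real (n div p + 1) * real p"
      by (metis of_nat_mult of_nat_le_iff less_imp_le)
    thus "real n / real p \<le> real (n div p + 1)"
      using pos[OF p] by (simp only: divide_le_eq) auto
    show "0 \<le> ln (real p)" using pos[OF p] by simp
  qed
  finally show ?thesis using * assms by (smt (verit) mult_le_cancel_left_pos of_nat_0_less_iff)
qed

lemma sum_inverse_primes_minus_le:
  assumes "n \<ge> 2"
  shows "(\<Sum>p\<in>primes_le n. 1 / p) - (\<Sum>p\<in>primes_le n. ln p / p) / ln n
           \<le> ln (ln n) - ln (ln 2) + ln 4 / ln 2 - ln 4 / ln n"
  using assms
  \<comment> \<open>partial summation with weights \<open>1 / ln n\<close>, carried out as an induction: subtracting the
     boundary term on the left makes the summand at a prime \<open>n + 1\<close> cancel\<close>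
proof (induction n rule: dec_induct)
  case base
  have "primes_le 2 = {2}" by (auto simp: primes_le_def dest: prime_ge_2_nat)
  thus ?case by simp
next
  case (step n)
  let ?A = "\<lambda>n. \<Sum>p\<in>primes_le n. ln (real p) / p"
  let ?S = "\<lambda>n. \<Sum>p\<in>primes_le n. 1 / real p"
  define u where "u = ln (real n)"
  define w where "w = ln (real (Suc n))"
  have uw: "0 < u" "u \<le> w" using step by (auto simp: u_def w_def)
  have "?S (Suc n) - ?A (Suc n) / w = ?S n - ?A n / w"
    using uw by (auto simp: primes_le_Suc primes_le_def[of n] w_def[symmetric] field_simps
      simp flip: of_nat_Suc simp del: of_nat_Suc)
  also have "\<dots> = (?S n - ?A n / u) + ?A n * (1 / u - 1 / w)"
    by (simp add: algebra_simps)
  also have "?A n * (1 / u - 1 / w) \<le> (u + ln 4) * (1 / u - 1 / w)"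
    using sum_ln_primes_over_le[of n] step uw
    by (intro mult_right_mono) (auto simp: u_def[symmetric] frac_le)
  \<comment> \<open>The second bracket telescopes exactly. The first is at most the increment of ln
    (ln n), because 1 - t \<le> - ln t at t = u / w.\<close>
  also have "(u + ln 4) * (1 / u - 1 / w) = (1 - u / w) + (ln 4 / u - ln 4 / w)"
    using uw by (simp add: field_simps)
  also have "1 - u / w \<le> ln w - ln u"
    using ln_le_minus_one[of "u / w"] uw by (simp add: ln_div)
  finally show ?case using step.IH unfolding u_def w_def by linarith
qed

lemma sum_inverse_primes_le:
  assumes "n \<ge> 2"
  shows "(\<Sum>p\<in>primes_le n. 1 / p) \<le> ln (ln n) - ln (ln 2) + 3"
proof -
  have n: "ln (real n) > 0" using assms by simp
  have "(\<Sum>p\<in>primes_le n. ln p / p) / ln n \<le> (ln n + ln 4) / ln n"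
    using sum_ln_primes_over_le[of n] assms n by (intro divide_right_mono) auto
  also have "\<dots> = 1 + ln 4 / ln n" using n by (simp add: add_divide_distrib)
  \<comment> \<open>The terms \<open>ln 4 / ln n\<close> cancel, and the constant is 1 + ln 4 / ln 2
    = 3.\<close>
  finally show ?thesis
    using sum_inverse_primes_minus_le[OF assms] ln_realpow[of 2 2] by simp
qed

text \<open>The inequality 1 + t \<le> exp t turns the product into the exponential of the prime
  sum.\<close>

lemma prod_one_plus_inverse_primes_le:
  assumes "n \<ge> 2"
  shows "(\<Prod>p\<in>primes_le n. 1 + 1 / real p) \<le> exp 3 / ln 2 * ln n"
proof -
  have "(\<Prod>p\<in>primes_le n. 1 + 1 / real p) \<le> (\<Prod>p\<in>primes_le n. exp (1 / real p))"
    by (intro prod_mono) (auto simp: exp_ge_add_one_self add_nonneg_nonneg)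
  also have "\<dots> = exp (\<Sum>p\<in>primes_le n. 1 / p)"
    by (simp add: exp_sum)
  also have "\<dots> \<le> exp (ln (ln n) - ln (ln 2) + 3)"
    using sum_inverse_primes_le[OF assms] by simp
  also have "\<dots> = exp 3 / ln 2 * ln n"
    using assms by (simp add: exp_add exp_diff)
  finally show ?thesis .
qed

section \<open>Assembling the local bounds\<close>

theorem theorem3p7:
  shows "\<exists>c::real. c > 0 \<and>
    (\<forall>\<^sub>F B::real in at_top. \<forall>(N::nat) (k::nat) (m::nat).
       m = \<Prod>{r::nat. prime r \<and> 2 < r \<and> real r \<le> B} \<longrightarrow> gcd (N * k) m = 1 \<longrightarrow>
       real (card (hyperbola_values N m k))
         \<le> c * (real m * ln B / 2 ^ card (prime_factors m)))"
proof (intro exI conjI)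
  show "exp 3 / ln 2 > (0::real)" by simp
  show "\<forall>\<^sub>F B::real in at_top. \<forall>(N::nat) (k::nat) (m::nat).
       m = \<Prod>{r::nat. prime r \<and> 2 < r \<and> real r \<le> B} \<longrightarrow> gcd (N * k) m = 1 \<longrightarrow>
       real (card (hyperbola_values N m k))
         \<le> exp 3 / ln 2 * (real m * ln B / 2 ^ card (prime_factors m))"
    using eventually_ge_at_top[of 2]
  proof (eventually_elim, intro allI impI)
    fix B :: real and N k m :: nat
    assume B: "2 \<le> B" and m: "m = \<Prod>{r::nat. prime r \<and> 2 < r \<and> real r \<le> B}"
      and cop: "gcd (N * k) m = 1"
    define P where "P = {r::nat. prime r \<and> 2 < r \<and> real r \<le> B}"
    \<comment> \<open>The prime estimates are indexed by naturals, so \<open>B\<close> is rounded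
      down; B \<ge> 2 keeps \<open>n\<close> in their range.\<close>
    define n where "n = nat \<lfloor>B\<rfloor>"
    have n: "2 \<le> n" "real n \<le> B" using B by (auto simp: n_def le_nat_floor)
    have sub: "P \<subseteq> primes_le n"
      by (auto simp: P_def primes_le_def n_def le_nat_floor)
    have fin: "finite P" using finite_subset[OF sub] by simp
    have m: "m = \<Prod>P" using m by (simp add: P_def)
    have prime: "prime p" if "p \<in> P" for p using that by (simp add: P_def)
    have pos: "real p > 0" if "p \<in> P" for p using prime[OF that] prime_gt_0_nat by simp
    have "prime_factors m = P"
      unfolding m using fin prime
      by (subst prime_factors_prod) (auto simp: prime_prime_factors dest: prime)
    have ndvd: "\<not> p dvd N * k" if "p \<in> P" for p
    proof
      assume "p dvd N * k"
      moreover have "p dvd m" unfolding m using fin that by (rule dvd_prodI)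
      ultimately have "p dvd 1" using cop by (metis gcd_greatest)
      thus False using prime[OF that] by simp
    qed
    \<comment> \<open>Including the prime 2 only enlarges the product, since every factor is at
      least 1.\<close>
    have "(\<Prod>p\<in>P. 1 + 1 / real p) \<le> (\<Prod>p\<in>primes_le n. 1 + 1 / real p)"
      using sub by (intro prod_mono2) auto
    also have "\<dots> \<le> exp 3 / ln 2 * ln n"
      using n by (intro prod_one_plus_inverse_primes_le)
    also have "\<dots> \<le> exp 3 / ln 2 * ln B"
      using n by (intro mult_left_mono) auto
    finally have bound: "(\<Prod>p\<in>P. 1 + 1 / real p) \<le> exp 3 / ln 2 * ln B" .
    have "real (card (hyperbola_values N m k)) \<le> (\<Prod>p\<in>P. (real p + 1) / 2)"
      unfolding m using fin prime ndvd by (rule card_hyperbola_values_prod_primes_le)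
    \<comment> \<open>Each local factor splits into p, 1 + 1 / p and 1 / 2; their products are m,
      the Mertens product and the power of 2 in the denominator.\<close>
    also have "\<dots> = (\<Prod>p\<in>P. real p * (1 + 1 / real p) / 2)"
      using pos by (intro prod.cong) (auto simp: field_simps dest: pos)
    also have "\<dots> = real m / 2 ^ card P * (\<Prod>p\<in>P. 1 + 1 / real p)"
      by (simp add: m prod.distrib prod_dividef)
    also have "\<dots> \<le> real m / 2 ^ card P * (exp 3 / ln 2 * ln B)"
      using bound by (intro mult_left_mono) auto
    also have "\<dots> = exp 3 / ln 2 * (real m * ln B / 2 ^ card (prime_factors m))"
      using \<open>prime_factors m = P\<close> by (simp add: mult_ac)
    finally show "real (card (hyperbola_values N m k))
         \<le> exp 3 / ln 2 * (real m * ln B / 2 ^ card (prime_factors m))" .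
  qed
qed

end
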